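(* Let $s\in\mathbb N$, let $k,m,n\in\mathbb N_0$ with $m+n>0$, and let $a$ be a number. Define the polynomial $$P_{m,n,s}(x;a)=(x+a)^{m+1}(x+a-s-1)^{n+1}+(-1)^{m+n}(x-a)^{n+1}(x-a-s-1)^{m+1},$$ and let $P_{m,n,s}^{(k)}(l;a)=\frac{d^k}{dx^k}P_{m,n,s}(x;a)\big|_{x=l}$. Let $\delta_{s,k}=(-1)^s-(-1)^k$ (so $\delta_{s,k}=2$ if $s$ is even and $k$ odd, $\delta_{s,k}=-2$ if $s$ is odd and $k$ even, and $\delta_{s,k}=0$ otherwise). Then $$\begin{aligned} &\delta_{s,k}\biggl( \sum_{i=0}^{m+1}(s+1)^{m-i+1}\binom{m+1}i\binom{n+i+1}{k}E_{n+i-k+1}(a)\\ &\qquad +(-1)^{m+n} \sum_{j=0}^{n+1}(s+1)^{n-j+1}\binom{n+1}j\binom{m+j+1}{k}E_{m+j-k+1}(-a)\biggr) =\frac2{k!}\sum_{l=1}^s(-1)^lP_{m,n,s}^{(k)}(l;a). \end{aligned}$$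
   Context: The Euler polynomials $E_n(a)$, $n\in\mathbb N_0$, are defined by $\frac{2e^{at}}{e^t+1}=\sum_{n=0}^\infty E_n(a)\frac{t^n}{n!}$. $\binom{N}{k}$ is the binomial coefficient, equal to $0$ when $k>N$; any term whose binomial coefficient vanishes (in particular any term in which an Euler polynomial would have negative index) is interpreted as $0$. *)

theory Defs
  imports Complex_Main "HOL-Computational_Algebra.Computational_Algebra"
begin

text \<open>
  The Euler polynomials, through their exponential generating function
  \<open>2 e^(a t) / (e^t + 1)\<close>, read as a formal power series in \<open>t\<close>.  The constant
  coefficient of the denominator is \<open>2\<close>, so the quotient is a genuine one.
\<close>

definition euler_poly :: "nat \<Rightarrow> complex \<Rightarrow> complex" where
  "euler_poly n a = fact n * fps_nth (2 * fps_exp a / (fps_exp 1 + 1)) n"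

definition P_poly :: "nat \<Rightarrow> nat \<Rightarrow> nat \<Rightarrow> complex \<Rightarrow> complex poly" where
  "P_poly m n s a =
     [:a, 1:] ^ (m + 1) * [:a - of_nat s - 1, 1:] ^ (n + 1)
     + (-1) ^ (m + n) * [:- a, 1:] ^ (n + 1) * [:- a - of_nat s - 1, 1:] ^ (m + 1)"

definition delta :: "nat \<Rightarrow> nat \<Rightarrow> complex" where
  "delta s k = (-1) ^ s - (-1) ^ k"

end

theory Submission
  imports Defs
begin

text \<open>
  Let \<open>L\<close> be the linear functional on polynomials with \<open>L(x^n) = E_n(0)\<close>. Then
  \<open>L((x + a)^n) = E_n(a)\<close>, the difference equation \<open>E_n(a + 1) + E_n(a) = 2 a^n\<close> becomes
  \<open>L(p(x + 1)) + L(p) = 2 p(0)\<close>, and the reflection formula becomes \<open>L(p(-1 - x)) = L(p)\<close>.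
  By the binomial theorem the left-hand bracket equals \<open>L(p(x + s + 1)) / k!\<close> for the
  \<open>k\<close>-th derivative \<open>p\<close> of \<open>P\<close>. Telescoping the difference equation expresses
  \<open>L(p) + (-1)^s L(p(x + s + 1))\<close> by the values \<open>p(0), \<dots>, p(s)\<close>, while the symmetry
  \<open>P(s + 1 - x) = P(x)\<close> gives \<open>L(p) = (-1)^k (2 p(s + 1) - L(p(x + s + 1)))\<close>.
  Eliminating \<open>L(p)\<close> yields the theorem.
\<close>

section \<open>Euler polynomials\<close>

definition euler_fps :: "complex \<Rightarrow> complex fps" where
  "euler_fps a = 2 * fps_exp a / (fps_exp 1 + 1)"

lemma euler_poly_eq: "euler_poly n a = fact n * fps_nth (euler_fps a) n"
  by (simp add: euler_poly_def euler_fps_def)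

lemma fps_exp_plus_1_neq_0: "fps_exp (1::complex) + 1 \<noteq> 0"
proof
  assume "fps_exp (1::complex) + 1 = 0"
  then have "fps_nth (fps_exp (1::complex) + 1) 0 = 0" by simp
  then show False by simp
qed

lemma euler_fps_mult: "euler_fps a * (fps_exp 1 + 1) = 2 * fps_exp a"
  by (simp add: euler_fps_def fps_divide_unit inverse_mult_eq_1 mult.assoc)

text \<open>Power series over a field form an integral domain, so the nonzero factor e^t + 1
  cancels. Identities between Euler series thus reduce to checking the defining equation.\<close>

lemma euler_fps_unique:
  assumes "f * (fps_exp 1 + 1) = 2 * fps_exp a"
  shows "f = euler_fps a"
proof -
  have "f * (fps_exp 1 + 1) = euler_fps a * (fps_exp 1 + 1)"
    using assms by (simp add: euler_fps_mult)
  then show ?thesis using fps_exp_plus_1_neq_0 by simp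
qed

lemma euler_fps_add: "euler_fps (a + b) = euler_fps a * fps_exp b"
proof (rule euler_fps_unique [symmetric])
  have "euler_fps a * fps_exp b * (fps_exp 1 + 1) = (euler_fps a * (fps_exp 1 + 1)) * fps_exp b"
    by (simp only: mult_ac)
  also have "\<dots> = 2 * fps_exp (a + b)"
    by (simp add: euler_fps_mult fps_exp_add_mult)
  finally show "euler_fps a * fps_exp b * (fps_exp 1 + 1) = 2 * fps_exp (a + b)" .
qed

text \<open>Substituting -t for t in the defining equation and multiplying by e^t turns the factor
  e^(-t) + 1 back into e^t + 1.\<close>

lemma euler_fps_reflect: "euler_fps (1 - a) = euler_fps a oo (- fps_X)"
proof (rule euler_fps_unique [symmetric])
  have "(euler_fps a * (fps_exp 1 + 1)) oo (- fps_X) = (fps_const 2 * fps_exp a) oo (- fps_X)"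
    by (simp add: euler_fps_mult numeral_fps_const)
  then have "(euler_fps a oo (- fps_X)) * (fps_exp (-1) + 1) = 2 * fps_exp (- a)"
    by (simp add: fps_compose_mult_distrib fps_compose_add_distrib numeral_fps_const)
  then have "(euler_fps a oo (- fps_X)) * ((fps_exp (-1) + 1) * fps_exp 1)
      = 2 * (fps_exp (- a) * fps_exp 1)"
    by (simp only: mult.assoc [symmetric])
  moreover have "(fps_exp (-1) + 1) * fps_exp 1 = fps_exp 1 + (1 :: complex fps)"
    using fps_exp_add_mult [of "-1" "1::complex"] by (simp add: distrib_right)
  moreover have "fps_exp (- a) * fps_exp 1 = fps_exp (1 - a)"
    using fps_exp_add_mult [of "-a" 1] by simp
  ultimately show "(euler_fps a oo (- fps_X)) * (fps_exp 1 + 1) = 2 * fps_exp (1 - a)"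
    by simp
qed

lemma euler_poly_add:
  "euler_poly n (a + b) = (\<Sum>i\<le>n. of_nat (n choose i) * b ^ (n - i) * euler_poly i a)"
  unfolding euler_poly_eq euler_fps_add fps_mult_nth sum_distrib_left atLeast0AtMost
  by (intro sum.cong) (simp_all add: binomial_fact)

lemma euler_poly_reflect: "euler_poly n (1 - a) = (-1) ^ n * euler_poly n a"
  by (simp add: euler_poly_eq euler_fps_reflect fps_compose_uminus')

lemma euler_poly_plus_1: "euler_poly n (a + 1) + euler_poly n a = 2 * a ^ n"
proof -
  have "fps_nth (euler_fps (a + 1) + euler_fps a) n = fps_nth (2 * fps_exp a) n"
    using euler_fps_mult [of a] by (simp only: euler_fps_add distrib_left mult_1_right)
  then have "fact n * (fps_nth (euler_fps (a + 1)) n + fps_nth (euler_fps a) n)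
      = fact n * (2 * (a ^ n / fact n))"
    by (simp add: numeral_fps_const)
  then show ?thesis
    by (simp add: euler_poly_eq distrib_left)
qed

section \<open>The umbral functional\<close>

definition euler_umbral :: "complex poly \<Rightarrow> complex" where
  "euler_umbral p = (\<Sum>i\<le>degree p. coeff p i * euler_poly i 0)"

text \<open>Coefficients beyond the degree vanish. A common bound \<open>d\<close> allows termwise
  comparison of polynomials of different degrees, which gives linearity.\<close>

lemma euler_umbral_altdef:
  assumes "degree p \<le> d"
  shows "euler_umbral p = (\<Sum>i\<le>d. coeff p i * euler_poly i 0)"
  unfolding euler_umbral_def using assms
  by (intro sum.mono_neutral_left) (auto intro: coeff_eq_0)

lemma euler_umbral_add: "euler_umbral (p + q) = euler_umbral p + euler_umbral q"
  using degree_add_le_max [of p q]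
  by (simp add: euler_umbral_altdef [of _ "max (degree p) (degree q)"] distrib_right sum.distrib)

lemma euler_umbral_smult: "euler_umbral (smult c p) = c * euler_umbral p"
  using degree_smult_le [of c p]
  by (simp add: euler_umbral_altdef [of _ "degree p"] sum_distrib_left mult.assoc)

lemma euler_umbral_0: "euler_umbral 0 = 0"
  using euler_umbral_smult [of 0 0] by simp

lemma euler_umbral_sum: "euler_umbral (sum f A) = (\<Sum>x\<in>A. euler_umbral (f x))"
  by (induction A rule: infinite_finite_induct) (simp_all add: euler_umbral_0 euler_umbral_add)

lemma euler_umbral_linear_power: "euler_umbral ([:a, 1:] ^ n) = euler_poly n a"
proof -
  have "degree ([:a, 1:] ^ n) \<le> n"
    using degree_power_le [of "[:a, 1:]" n] by simp
  then have "euler_umbral ([:a, 1:] ^ n) = (\<Sum>i\<le>n. coeff ([:a, 1:] ^ n) i * euler_poly i 0)"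
    by (rule euler_umbral_altdef)
  also have "\<dots> = euler_poly n (0 + a)"
    unfolding euler_poly_add by (intro sum.cong) (simp_all add: coeff_linear_poly_power)
  finally show ?thesis by simp
qed

text \<open>Monomials appear as powers of \<open>[:0, 1:]\<close> so that composing them with a
  linear polynomial gives powers of linear polynomials, to which
  \<open>euler_umbral_linear_power\<close> applies.\<close>

lemma poly_induct_powers:
  fixes P :: "'a::comm_ring_1 poly \<Rightarrow> bool"
  assumes "P 0"
    and "\<And>p q. P p \<Longrightarrow> P q \<Longrightarrow> P (p + q)"
    and "\<And>c n. P (smult c ([:0, 1:] ^ n))"
  shows "P p"
proof -
  have "P (\<Sum>i\<in>A. smult (coeff p i) ([:0, 1:] ^ i))" for A
    by (induction A rule: infinite_finite_induct) (simp_all add: assms)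
  then show ?thesis
    using poly_as_sum_of_monoms [of p] by (metis (no_types, lifting) monom_altdef sum.cong)
qed

lemma pcompose_power: "pcompose (p ^ n) r = pcompose p r ^ n" for p :: "'a::comm_ring_1 poly"
  by (induction n) (simp_all add: pcompose_1 pcompose_mult)

lemma euler_umbral_shift:
  "euler_umbral (pcompose p [:1, 1:]) + euler_umbral p = 2 * poly p 0"
proof (induction p rule: poly_induct_powers)
  case (3 c n)
  have "c * (euler_poly n 1 + euler_poly n 0) = c * (2 * 0 ^ n)"
    using euler_poly_plus_1 [of n 0] by simp
  then show ?case
    by (simp add: pcompose_smult pcompose_power pcompose_pCons euler_umbral_smult
        euler_umbral_linear_power algebra_simps)
next
  case (2 p q)
  have "euler_umbral (pcompose (p + q) [:1, 1:]) + euler_umbral (p + q) =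
      (euler_umbral (pcompose p [:1, 1:]) + euler_umbral p) +
      (euler_umbral (pcompose q [:1, 1:]) + euler_umbral q)"
    by (simp only: pcompose_add euler_umbral_add add_ac)
  then show ?case by (simp only: 2 poly_add distrib_left)
qed (simp_all add: euler_umbral_0)

lemma euler_umbral_reflect: "euler_umbral (pcompose p [:-1, -1:]) = euler_umbral p"
proof (induction p rule: poly_induct_powers)
  case (3 c n)
  \<comment> \<open>On x^n the claim is the reflection formula at 1, since (-1 - x)^n = (-1)^n (x +
    1)^n.\<close>
  have "[:-1, -1:] = smult (-1) [:1, 1 :: complex:]" by simp
  then have "[:-1, -1:] ^ n = smult ((-1) ^ n) ([:1, 1 :: complex:] ^ n)"
    by (simp only: smult_power)
  moreover have "euler_poly n 0 = (-1) ^ n * euler_poly n 1"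
    using euler_poly_reflect [of n 1] by simp
  ultimately show ?case
    by (simp add: pcompose_smult pcompose_power pcompose_pCons euler_umbral_smult
        euler_umbral_linear_power)
qed (simp_all add: pcompose_add euler_umbral_add euler_umbral_0)

lemma euler_umbral_telescope:
  "euler_umbral p - (-1) ^ N * euler_umbral (pcompose p [:of_nat N, 1:])
     = 2 * (\<Sum>l<N. (-1) ^ l * poly p (of_nat l))"
proof (induction N)
  case (Suc N)
  let ?q = "pcompose p [:of_nat N, 1:]"
  have "pcompose ?q [:1, 1:] = pcompose p [:of_nat (Suc N), 1:]"
    by (simp add: pcompose_assoc [symmetric] pcompose_pCons add.commute)
  then have "euler_umbral (pcompose p [:of_nat (Suc N), 1:]) =
      2 * poly p (of_nat N) - euler_umbral ?q"
    using euler_umbral_shift [of ?q] by (simp add: poly_pcompose algebra_simps)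
  then have "(-1) ^ N * euler_umbral (pcompose p [:of_nat (Suc N), 1:]) =
      (-1) ^ N * (2 * poly p (of_nat N) - euler_umbral ?q)"
    by (simp only:)
  then show ?case using Suc.IH by (simp add: algebra_simps)
qed simp

lemma euler_umbral_symmetric:
  assumes sym: "pcompose p [:of_nat (Suc s), -1:] = smult ((-1) ^ k) p"
  shows "delta s k * euler_umbral (pcompose p [:of_nat (Suc s), 1:])
     = 2 * (\<Sum>l=1..s. (-1) ^ l * poly p (of_nat l))"
proof -
  let ?N = "of_nat (Suc s) :: complex"
  let ?q = "pcompose p [:?N, 1:]"
  have sign: "(-1) ^ k * ((-1) ^ k * z) = z" for z :: complex
    by (simp add: mult.assoc [symmetric] power_add [symmetric])
  have "poly (pcompose p [:?N, -1:]) 0 = (-1) ^ k * poly p 0"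
    by (simp only: sym poly_smult)
  then have p0: "(-1) ^ k * poly p ?N = poly p 0"
    by (simp add: poly_pcompose sign)
  \<comment> \<open>Putting -1 - x for x in N - x gives x + 1 + N, so reflection invariance turns
    the symmetry of \<open>p\<close> into a statement about a shift of \<open>?q\<close>.\<close>
  have "pcompose (pcompose p [:?N, -1:]) [:-1, -1:] = pcompose ?q [:1, 1:]"
    by (simp add: pcompose_assoc [symmetric] pcompose_pCons)
  then have "(-1) ^ k * euler_umbral p = euler_umbral (pcompose ?q [:1, 1:])"
    using euler_umbral_reflect [of "pcompose p [:?N, -1:]"] by (simp only: sym euler_umbral_smult)
  also have "\<dots> = 2 * poly p ?N - euler_umbral ?q"
    using euler_umbral_shift [of ?q] by (simp add: poly_pcompose algebra_simps)
  finally have "(-1) ^ k * ((-1) ^ k * euler_umbral p)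
      = (-1) ^ k * (2 * poly p ?N - euler_umbral ?q)"
    by simp
  then have "euler_umbral p = 2 * ((-1) ^ k * poly p ?N) - (-1) ^ k * euler_umbral ?q"
    by (simp add: sign algebra_simps)
  then have reflected: "euler_umbral p = 2 * poly p 0 - (-1) ^ k * euler_umbral ?q"
    by (simp only: p0)
  \<comment> \<open>Telescoping over s + 1 steps includes l = 0; that term cancels the 2 p(0) of
    \<open>reflected\<close>, and the signs left on \<open>?q\<close> combine to
    \<open>delta s k\<close>.\<close>
  have "(\<Sum>l<Suc s. (-1) ^ l * poly p (of_nat l))
      = poly p 0 + (\<Sum>l=1..s. (-1) ^ l * poly p (of_nat l))"
    by (simp add: lessThan_Suc_atMost atMost_atLeast0 sum.atLeast_Suc_atMost)
  then have "2 * poly p 0 - (-1) ^ k * euler_umbral ?q - (-1) ^ Suc s * euler_umbral ?q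
      = 2 * (poly p 0 + (\<Sum>l=1..s. (-1) ^ l * poly p (of_nat l)))"
    using euler_umbral_telescope [of p "Suc s"] by (simp only: reflected)
  then show ?thesis by (simp add: delta_def algebra_simps)
qed

section \<open>Higher derivatives\<close>

lemma higher_pderiv_pcompose_linear:
  fixes p :: "'a::idom poly"
  shows "(pderiv ^^ k) (pcompose p [:b, c:]) = smult (c ^ k) (pcompose ((pderiv ^^ k) p) [:b, c:])"
  by (induction k) (simp_all add: pderiv_smult pderiv_pcompose pderiv_pCons mult.commute)

lemma higher_pderiv_linear_power:
  "(pderiv ^^ k) ([:b, 1:] ^ n) = smult (fact k * of_nat (n choose k)) ([:b, 1:] ^ (n - k))"
  for b :: "'a::{idom,semiring_char_0}"
proof (induction k)
  case (Suc k)
  \<comment> \<open>The new factor n - k is absorbed into the next binomial. For k \<ge> n both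
    sides are 0, so truncated subtraction does no harm.\<close>
  have "(n - k) * (n choose k) = Suc k * (n choose Suc k)"
    by (simp only: binomial_absorb_comp binomial_absorption)
  then have "fact k * (n choose k) * (n - k) = fact (Suc k) * (n choose Suc k)"
    by (metis fact_Suc mult.assoc mult.commute of_nat_id)
  then have "of_nat (fact k * (n choose k) * (n - k)) = (of_nat (fact (Suc k) * (n choose Suc k)) :: 'a)"
    by (rule arg_cong)
  then show ?case
    by (simp add: Suc.IH pderiv_smult pderiv_power pderiv_pCons del: fact_Suc of_nat_Suc binomial_Suc_Suc)
qed simp

text \<open>Expanding the second factor around x + b leaves only powers of x + b, whose derivatives
  the functional sends to Euler polynomials at b. Where the index would be negative, the binomial
  coefficient is 0.\<close>

lemma euler_umbral_higher_pderiv: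
  "euler_umbral ((pderiv ^^ k) ([:b, 1:] ^ (q + 1) * [:b + c, 1:] ^ r)) =
     fact k * (\<Sum>i=0..r. c ^ (r - i) * of_nat (r choose i) * of_nat ((q + i + 1) choose k) *
       euler_poly (q + i + 1 - k) b)"
proof -
  have "[:b + c, 1:] ^ r = ([:b, 1:] + [:c:]) ^ r" by simp
  also have "\<dots> = (\<Sum>i=0..r. smult (c ^ (r - i) * of_nat (r choose i)) ([:b, 1:] ^ i))"
    by (simp only: binomial_ring atLeast0AtMost)
      (intro sum.cong, simp_all add: of_nat_poly poly_const_pow mult_ac)
  finally have "[:b, 1:] ^ (q + 1) * [:b + c, 1:] ^ r
      = (\<Sum>i=0..r. smult (c ^ (r - i) * of_nat (r choose i)) ([:b, 1:] ^ (q + i + 1)))"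
    by (simp only: sum_distrib_left mult_smult_right power_add [symmetric] add.commute
        add.left_commute)
  then show ?thesis
    by (simp add: higher_pderiv_sum higher_pderiv_smult higher_pderiv_linear_power
        euler_umbral_sum euler_umbral_smult euler_umbral_linear_power sum_distrib_left mult_ac
        del: power_Suc)
qed

text \<open>Both summands now have the shape required by \<open>euler_umbral_higher_pderiv\<close>,
  with c = s + 1 and base point a or -a.\<close>

lemma P_poly_shift:
  "pcompose (P_poly m n s a) [:of_nat (Suc s), 1:] =
     [:a, 1:] ^ (n + 1) * [:a + (of_nat s + 1), 1:] ^ (m + 1)
     + smult ((-1) ^ (m + n)) ([:- a, 1:] ^ (m + 1) * [:- a + (of_nat s + 1), 1:] ^ (n + 1))"
proof -
  \<comment> \<open>In \<open>P_poly\<close> the sign is a power of the constant polynomial -1; as a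
    scalar it can pass through linear maps.\<close>
  have sign: "(-1) ^ (m + n) * q = smult ((-1) ^ (m + n)) q" for q :: "complex poly"
    by (cases "even (m + n)") simp_all
  have "P_poly m n s a = [:a, 1:] ^ (m + 1) * [:a - of_nat s - 1, 1:] ^ (n + 1)
      + smult ((-1) ^ (m + n)) ([:- a, 1:] ^ (n + 1) * [:- a - of_nat s - 1, 1:] ^ (m + 1))"
    by (simp only: P_poly_def mult.assoc, simp only: sign)
  then show ?thesis
    by (simp add: pcompose_add pcompose_mult pcompose_power pcompose_pCons
        pcompose_smult algebra_simps del: power_Suc)
qed

text \<open>The substitution x -> s + 1 - x exchanges A with -D and B with -C, hence swaps the two
  summands; the m + n + 2 minus signs match the factor (-1)^(m + n).\<close>

lemma P_poly_symmetric: "pcompose (P_poly m n s a) [:of_nat (Suc s), -1:] = P_poly m n s a"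
proof (rule poly_eq_poly_eq_iff [THEN iffD1], rule ext)
  fix x
  define A B C D where "A = x + a" and "B = x + a - of_nat s - 1"
    and "C = x - a" and "D = x - a - of_nat s - 1"
  have "poly (pcompose (P_poly m n s a) [:of_nat (Suc s), -1:]) x
     = (- D) ^ (m + 1) * (- C) ^ (n + 1) + (-1) ^ (m + n) * ((- B) ^ (n + 1) * (- A) ^ (m + 1))"
    by (simp add: P_poly_def poly_pcompose A_def B_def C_def D_def algebra_simps del: power_Suc)
  also have "\<dots> = A ^ (m + 1) * B ^ (n + 1) + (-1) ^ (m + n) * (C ^ (n + 1) * D ^ (m + 1))"
    unfolding power_minus [of A] power_minus [of B] power_minus [of C] power_minus [of D]
    by (cases "even m"; cases "even n") simp_all
  also have "\<dots> = poly (P_poly m n s a) x"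
    by (simp add: P_poly_def A_def B_def C_def D_def algebra_simps del: power_Suc)
  finally show "poly (pcompose (P_poly m n s a) [:of_nat (Suc s), -1:]) x
     = poly (P_poly m n s a) x" .
qed

theorem theorem1p9:
  fixes s k m n :: nat and a :: complex
  assumes "s \<ge> 1" and "m + n > 0"
  shows "delta s k *
      ((\<Sum>i=0..m+1. (of_nat s + 1) ^ (m + 1 - i) * of_nat ((m + 1) choose i) *
           of_nat ((n + i + 1) choose k) * euler_poly (n + i + 1 - k) a)
       + (-1) ^ (m + n) *
         (\<Sum>j=0..n+1. (of_nat s + 1) ^ (n + 1 - j) * of_nat ((n + 1) choose j) *
           of_nat ((m + j + 1) choose k) * euler_poly (m + j + 1 - k) (- a)))
    = 2 / fact k * (\<Sum>l=1..s. (-1) ^ l * poly ((pderiv ^^ k) (P_poly m n s a)) (of_nat l))"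
    (is "delta s k * ?B = _")
proof -
  let ?p = "(pderiv ^^ k) (P_poly m n s a)"
  have "P_poly m n s a = pcompose (P_poly m n s a) [:of_nat (Suc s), -1:]"
    by (simp only: P_poly_symmetric)
  \<comment> \<open>Differentiating the symmetry k times gives (-1)^k by the chain rule. This sign
    is its own inverse, so it can be moved to the other side.\<close>
  then have "?p = smult ((-1) ^ k) (pcompose ?p [:of_nat (Suc s), -1:])"
    by (metis higher_pderiv_pcompose_linear)
  then have "smult ((-1) ^ k) ?p
      = smult ((-1) ^ k) (smult ((-1) ^ k) (pcompose ?p [:of_nat (Suc s), -1:]))"
    by (rule arg_cong)
  then have "pcompose ?p [:of_nat (Suc s), -1:] = smult ((-1) ^ k) ?p"
    by (simp add: power_add [symmetric])
  then have "delta s k * euler_umbral (pcompose ?p [:of_nat (Suc s), 1:])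
      = 2 * (\<Sum>l=1..s. (-1) ^ l * poly ?p (of_nat l))"
    by (rule euler_umbral_symmetric)
  moreover have "euler_umbral (pcompose ?p [:of_nat (Suc s), 1:]) = fact k * ?B"
  proof -
    \<comment> \<open>Translation commutes with differentiation, so the shifted form of P can be
      differentiated directly.\<close>
    have "pcompose ?p [:of_nat (Suc s), 1:]
        = (pderiv ^^ k) (pcompose (P_poly m n s a) [:of_nat (Suc s), 1:])"
      by (simp add: higher_pderiv_pcompose_linear)
    then show ?thesis
      by (simp only: P_poly_shift higher_pderiv_add higher_pderiv_smult euler_umbral_add
          euler_umbral_smult euler_umbral_higher_pderiv distrib_left mult.left_commute)
  qed
  ultimately have "delta s k * (fact k * ?B) = 2 * (\<Sum>l=1..s. (-1) ^ l * poly ?p (of_nat l))"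
    by (simp only:)
  then have "delta s k * ?B * fact k = 2 * (\<Sum>l=1..s. (-1) ^ l * poly ?p (of_nat l))"
    by (simp only: mult.assoc [of "delta s k"] mult.commute [of ?B])
  then have "delta s k * ?B = 2 * (\<Sum>l=1..s. (-1) ^ l * poly ?p (of_nat l)) / fact k"
    by (rule eq_divide_imp [OF fact_nonzero])
  then show ?thesis
    by (simp only: times_divide_eq_left)
qed

end
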